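(* Let $d\ge 0$ and let $f(z)=\sum_{j=0}^d A_j z^j$, with $A_j\in\mathbb{C}^{d+1}$ and $A_d\neq 0$, be a polynomial sphere map of degree $d$ from $\mathbb{C}$ to $\mathbb{C}^{d+1}$. Then there is an orthonormal basis $e_0,\dots,e_d$ of $\mathbb{C}^{d+1}$ such that, writing $A_j=\sum_{k=0}^d a_{jk}e_k$ with $a_{jk}\in\mathbb{C}$, the following hold: (i) $A_0=\|A_0\|\,e_0$ and $A_d=\|A_d\|\,e_d$; and, if $d\ge 2$, moreover: (ii) there is a complex number $\alpha$ with $a_{(d-1)0}=-\alpha\|A_d\|$ and $a_{1d}=\overline{\alpha}\,\|A_0\|$ (the remaining entries $a_{j0}$ and $a_{jd}$ of the first and last rows, not specified by (i) and (ii), are complex parameters); (iii) the inner matrix $(a_{jk})_{1\le j,k\le d-1}$ is upper triangular, where $j$ indexes columns and $k$ indexes rows, i.e. $a_{jk}=0$ whenever $1\le j<k\le d-1$; (iv) the first $d-2$ diagonal entries $a_{11},\dots,a_{(d-2)(d-2)}$ of the inner matrix are real and non-negative, and the last diagonal entry $a_{(d-1)(d-1)}$ is real, non-negative, and determined by the other entries through the identity $\sum_{j,k=0}^d |a_{jk}|^2=1$.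
   Context: $\langle\cdot,\cdot\rangle$ is the standard Hermitian inner product on $\mathbb{C}^{N}$ (linear in the first slot) and $\|\cdot\|$ its norm. A polynomial sphere map of degree $d$ from $\mathbb{C}$ to $\mathbb{C}^N$ is a polynomial map $f(z)=\sum_{j=0}^d A_jz^j$, $A_j\in\mathbb{C}^N$, $A_d\ne0$, with $\|f(z)\|=1$ whenever $|z|=1$. The matrix of $f$ in the basis $e_0,\dots,e_d$ has the coordinate vectors of $A_0,\dots,A_d$ as its columns; thus $a_{jk}$ is the entry in column $j$ and row $k$ (indices from $0$ to $d$), and the first and last rows consist of the entries $a_{j0}$ and $a_{jd}$, respectively. *)

theory Defs
  imports "HOL-Analysis.Analysis"
begin

text \<open>
  The inner product \<open>\<bullet>\<close> of the library on \<open>complex ^ 'n\<close> is real valued: it is the real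
  part of the Hermitian one, so the latter is introduced here (linear in the first slot).
  The library norm on \<open>complex ^ 'n\<close> is the norm it induces, see \<open>hinner_self\<close>.
\<close>

definition hinner :: "complex ^ 'n \<Rightarrow> complex ^ 'n \<Rightarrow> complex"
  where "hinner x y = (\<Sum>i\<in>UNIV. x $ i * cnj (y $ i))"

lemma hinner_self: "hinner x x = of_real ((norm x)\<^sup>2)"
  by (simp add: hinner_def norm_vec_def L2_set_def sum_nonneg complex_norm_square
      flip: of_real_power)

text \<open>Spanning is over \<open>\<complex>\<close>: \<open>vec.span\<close> refers to the scalar multiplication \<open>*s\<close>.\<close>

definition orthonormal_basis :: "nat \<Rightarrow> (nat \<Rightarrow> complex ^ 'n) \<Rightarrow> bool"
  where "orthonormal_basis d e \<longleftrightarrow>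
    (\<forall>j\<le>d. \<forall>k\<le>d. hinner (e j) (e k) = (if j = k then 1 else 0)) \<and>
    vec.span (e ` {..d}) = UNIV"

definition polynomial_sphere_map :: "nat \<Rightarrow> (complex \<Rightarrow> complex ^ 'n) \<Rightarrow> bool"
  where "polynomial_sphere_map d f \<longleftrightarrow>
    (\<exists>A. A d \<noteq> 0 \<and> (\<forall>z. f z = (\<Sum>j\<le>d. z ^ j *s A j))) \<and>
    (\<forall>z. norm z = 1 \<longrightarrow> norm (f z) = 1)"

end

theory Submission
  imports Defs "HOL-Computational_Algebra.Polynomial"
begin

text \<open>
  Expanding \<open>\<parallel>f z\<parallel>\<^sup>2 = 1\<close> on the unit circle gives a trigonometric polynomial identity, and
  comparing Fourier coefficients shows that the sum of the Hermitian products of all pairs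
  \<open>A (k + l)\<close>, \<open>A k\<close> is \<open>1\<close> for \<open>l = 0\<close> and \<open>0\<close> for \<open>l > 0\<close>
  (\<open>sphere_map_coefficient_relations\<close>). Three of these relations matter. The case \<open>l = d > 0\<close>
  says that \<open>A 0\<close> and \<open>A d\<close> are orthogonal, the case \<open>l = d - 1 > 0\<close> links the two corner entries that
  \<open>\<alpha>\<close> parametrizes, and the case \<open>l = 0\<close> says that the squared entries of the matrix sum to \<open>1\<close>.

  The basis itself comes from the Gram-Schmidt process, applied to the list
  \<open>A d, A 0, A 1, \<dots>, A (d - 1)\<close> in this order. Whenever a vector depends on its predecessors,
  any unit vector orthogonal to the basis vectors found so far will do
  (\<open>triangular_orthonormalization\<close>). The matrix of the list is then upper
  triangular with real non-negative diagonal. Numbering the basis vectors \<open>e d, e 0, \<dots>,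
  e (d - 1)\<close> turns this into the triangularity of the inner matrix, and the orthogonality of
  \<open>A 0\<close> and \<open>A d\<close> into the statement about the outer columns. That \<open>A d\<close> comes first matters when
  \<open>A 0 = 0\<close>: then \<open>e 0\<close> is arbitrary up to being orthogonal to \<open>A d\<close>.
\<close>

section \<open>The Hermitian inner product\<close>

lemma hinner_add_left: "hinner (x + y) z = hinner x z + hinner y z"
  by (simp add: hinner_def distrib_right sum.distrib)

lemma hinner_diff_left: "hinner (x - y) z = hinner x z - hinner y z"
  by (simp add: hinner_def left_diff_distrib sum_subtractf)

lemma hinner_scale_left: "hinner (c *s x) y = c * hinner x y"
  by (simp add: hinner_def sum_distrib_left mult.assoc)

lemma hinner_zero_left [simp]: "hinner 0 y = 0"
  by (simp add: hinner_def)

lemma cnj_hinner: "cnj (hinner x y) = hinner y x"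
  by (simp add: hinner_def mult.commute)

lemma hinner_scale_right: "hinner x (c *s y) = cnj c * hinner x y"
  by (simp add: hinner_def sum_distrib_left algebra_simps)

lemma hinner_sum_left: "hinner (\<Sum>i\<in>I. g i) y = (\<Sum>i\<in>I. hinner (g i) y)"
  by (induction I rule: infinite_finite_induct) (simp_all add: hinner_add_left)

lemma hinner_sum_right: "hinner x (\<Sum>i\<in>I. g i) = (\<Sum>i\<in>I. hinner x (g i))"
  by (metis (mono_tags, lifting) cnj_hinner cnj_sum hinner_sum_left sum.cong)

section \<open>Orthogonality relations between the coefficients\<close>

text \<open>
  On the circle \<open>cnj z = 1 / z\<close>, so multiplying \<open>\<parallel>f z\<parallel>\<^sup>2 - 1\<close> by \<open>z ^ d\<close> yields an honest polynomial
  in \<open>z\<close>. It vanishes on the circle, which is infinite, and hence all of its coefficients are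
  zero; the relation for \<open>l\<close> is the coefficient of \<open>z ^ (d + l)\<close>.
\<close>

lemma sphere_map_coefficient_relations:
  fixes A :: "nat \<Rightarrow> complex ^ 'n"
  assumes sphere: "\<And>z. norm z = 1 \<Longrightarrow> norm (\<Sum>j\<le>d. z ^ j *s A j) = 1"
    and "l \<le> d"
  shows "(\<Sum>k\<le>d - l. hinner (A (k + l)) (A k)) = (if l = 0 then 1 else 0)"
proof -
  define p where
    "p = (\<Sum>k\<le>d. \<Sum>j\<le>d. monom (hinner (A j) (A k)) (d + j - k)) - monom 1 d"
  have root: "poly p z = 0" if z: "norm z = 1" for z
  proof -
    have zz: "z * cnj z = 1"
      using z by (simp add: complex_norm_square[symmetric])
    have shift: "z ^ (d + j - k) = z ^ d * (z ^ j * cnj z ^ k)" if "k \<le> d" for j k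
    proof -
      have "z ^ d * (z ^ j * cnj z ^ k) = z ^ (d + j - k + k) * cnj z ^ k"
        using that by (simp add: power_add)
      also have "\<dots> = z ^ (d + j - k) * (z * cnj z) ^ k"
        by (simp only: power_add power_mult_distrib mult.assoc)
      finally show ?thesis by (simp add: zz)
    qed
    let ?F = "\<Sum>j\<le>d. z ^ j *s A j"
    have "(\<Sum>k\<le>d. \<Sum>j\<le>d. z ^ d * (z ^ j * cnj z ^ k) * hinner (A j) (A k))
        = z ^ d * hinner ?F ?F"
      by (simp add: hinner_sum_left hinner_sum_right hinner_scale_left hinner_scale_right
          sum_distrib_left mult.assoc mult.left_commute)
    also have "\<dots> = z ^ d"
      using sphere[OF z] by (simp add: hinner_self)
    finally show ?thesis
      by (simp add: p_def poly_sum poly_monom shift mult.commute)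
  qed
  have "infinite (sphere 0 1 :: complex set)"
  proof (rule uncountable_infinite, rule connected_uncountable)
    show "connected (sphere 0 1 :: complex set)"
      by (rule connected_sphere) simp
    show "(1::complex) \<in> sphere 0 1" "(-1::complex) \<in> sphere 0 1" "(1::complex) \<noteq> -1"
      by simp_all
  qed
  moreover have "sphere 0 1 \<subseteq> {z. poly p z = 0}"
    using root by auto
  ultimately have "infinite {z. poly p z = 0}"
    by (meson finite_subset)
  then have "p = 0"
    using poly_roots_finite by auto
  then have "0 = coeff p (d + l)" by simp
  also have "\<dots> = (\<Sum>k\<le>d. \<Sum>j\<le>d. if d + j - k = d + l then hinner (A j) (A k) else 0)
      - (if l = 0 then 1 else 0)"
    by (simp add: p_def coeff_sum)
  also have "(\<Sum>k\<le>d. \<Sum>j\<le>d. if d + j - k = d + l then hinner (A j) (A k) else 0)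
      = (\<Sum>k\<le>d. \<Sum>j\<le>d. if j = k + l then hinner (A j) (A k) else 0)"
    by (intro sum.cong refl) auto
  also have "\<dots> = (\<Sum>k\<le>d. if k + l \<le> d then hinner (A (k + l)) (A k) else 0)"
    by (simp add: sum.delta')
  also have "\<dots> = (\<Sum>k\<in>{k\<in>{..d}. k + l \<le> d}. hinner (A (k + l)) (A k))"
    by (rule sum.inter_filter[symmetric]) simp
  also have "{k\<in>{..d}. k + l \<le> d} = {..d - l}"
    using \<open>l \<le> d\<close> by auto
  finally show ?thesis by simp
qed

section \<open>Triangular orthonormalization\<close>

definition orthonormal_seq :: "nat \<Rightarrow> (nat \<Rightarrow> complex ^ 'n) \<Rightarrow> bool"
  where "orthonormal_seq n u \<longleftrightarrow>
    (\<forall>j<n. \<forall>k<n. hinner (u j) (u k) = (if j = k then 1 else 0))"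

text \<open>The component of \<open>x\<close> orthogonal to \<open>u 0, \<dots>, u (n - 1)\<close> when these are orthonormal.\<close>

definition residual :: "nat \<Rightarrow> (nat \<Rightarrow> complex ^ 'n) \<Rightarrow> complex ^ 'n \<Rightarrow> complex ^ 'n"
  where "residual n u x = x - (\<Sum>k<n. hinner x (u k) *s u k)"

lemma hinner_residual:
  assumes "orthonormal_seq n u" "k < n"
  shows "hinner (residual n u x) (u k) = 0"
proof -
  have "(\<Sum>i<n. hinner x (u i) * hinner (u i) (u k)) = (\<Sum>i<n. if i = k then hinner x (u i) else 0)"
    using assms by (intro sum.cong) (auto simp: orthonormal_seq_def)
  then show ?thesis
    using assms(2) by (simp add: residual_def hinner_diff_left hinner_sum_left hinner_scale_left)
qed

lemma orthonormal_seq_independent: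
  assumes "orthonormal_seq n u"
  shows "inj_on u {..<n}" "vec.independent (u ` {..<n})"
proof -
  show inj: "inj_on u {..<n}"
  proof (rule inj_onI)
    fix j k assume jk: "j \<in> {..<n}" "k \<in> {..<n}" "u j = u k"
    have "hinner (u j) (u k) = 1"
      using assms jk(2) by (simp add: orthonormal_seq_def jk(3))
    moreover have "hinner (u j) (u k) = (if j = k then 1 else 0)"
      using assms jk(1,2) by (simp add: orthonormal_seq_def)
    ultimately show "j = k"
      by (simp split: if_splits)
  qed
  show "vec.independent (u ` {..<n})"
  proof (rule vec.independent_if_scalars_zero)
    fix c x assume 0: "(\<Sum>x\<in>u ` {..<n}. c x *s x) = 0" and "x \<in> u ` {..<n}"
    then obtain k where k: "k < n" "x = u k" by auto
    have "0 = hinner (\<Sum>i<n. c (u i) *s u i) (u k)"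
      using 0 by (simp add: sum.reindex[OF inj])
    also have "\<dots> = (\<Sum>i<n. c (u i) * hinner (u i) (u k))"
      by (simp add: hinner_sum_left hinner_scale_left)
    also have "\<dots> = (\<Sum>i<n. if i = k then c (u i) else 0)"
      using assms k by (intro sum.cong) (auto simp: orthonormal_seq_def)
    finally show "c x = 0" using k by simp
  qed simp
qed

lemma orthonormal_seq_span:
  fixes u :: "nat \<Rightarrow> complex ^ 'n"
  assumes "orthonormal_seq CARD('n) u"
  shows "vec.span (u ` {..<CARD('n)}) = UNIV"
proof -
  note ind = orthonormal_seq_independent[OF assms]
  have "card (u ` {..<CARD('n)}) = CARD('n)"
    using ind(1) by (simp add: card_image)
  with ind(2) have "UNIV \<subseteq> vec.span (u ` {..<CARD('n)})"
    by (intro vec.card_ge_dim_independent) (auto simp: vec_dim_card simp del: vec.dim_UNIV)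
  then show ?thesis by blast
qed

text \<open>
  One Gram-Schmidt step. The new vector \<open>w\<close> is the normalized residual of \<open>v\<close>; if that residual
  vanishes, then \<open>c = 0\<close>, and \<open>w\<close> is the normalized residual of any vector outside the span, which
  is a proper subspace because \<open>n\<close> is less than the dimension.
\<close>

lemma orthonormal_extension:
  fixes u :: "nat \<Rightarrow> complex ^ 'n"
  assumes u: "orthonormal_seq n u" and n: "n < CARD('n)"
  obtains w c where "hinner w w = 1" "\<And>k. k < n \<Longrightarrow> hinner w (u k) = 0"
    "0 \<le> c" "residual n u v = complex_of_real c *s w"
proof -
  have normalize: "hinner w w = 1 \<and> (\<forall>k<n. hinner w (u k) = 0) \<and>
      residual n u x = complex_of_real (norm (residual n u x)) *s w"
    if "residual n u x \<noteq> 0" "w = complex_of_real (inverse (norm (residual n u x))) *s residual n u x"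
    for x w
  proof (intro conjI allI impI)
    define c where "c = norm (residual n u x)"
    have c: "c \<noteq> 0" and w: "w = complex_of_real (inverse c) *s residual n u x"
      using that by (simp_all add: c_def)
    have "hinner (residual n u x) (residual n u x) = complex_of_real (c\<^sup>2)"
      by (simp add: hinner_self c_def)
    then show "hinner w w = 1"
      using c by (simp add: w hinner_scale_left hinner_scale_right power2_eq_square field_simps)
    show "hinner w (u k) = 0" if "k < n" for k
      using hinner_residual[OF u that] by (simp add: w hinner_scale_left)
    show "residual n u x = complex_of_real (norm (residual n u x)) *s w"
      using c by (simp add: w flip: c_def)
  qed
  show thesis
  proof (cases "residual n u v = 0")
    case False
    then show thesis
      using normalize[OF False refl] that norm_ge_zero by blast
  next
    case True
    have "vec.dim (u ` {..<n}) \<le> n"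
      using vec.dim_le_card[OF vec.span_superset, of "u ` {..<n}"] card_image_le[of "{..<n}" u]
      by simp
    then have "vec.span (u ` {..<n}) \<noteq> UNIV"
      using n by (metis vec.dim_span vec_dim_card not_le)
    then obtain x where x: "x \<notin> vec.span (u ` {..<n})" by blast
    have "(\<Sum>k<n. hinner x (u k) *s u k) \<in> vec.span (u ` {..<n})"
      by (intro vec.span_sum vec.span_scale vec.span_base) auto
    with x have "residual n u x \<noteq> 0"
      by (auto simp: residual_def)
    from normalize[OF this refl] show thesis
      using that[of _ 0] True by auto
  qed
qed

text \<open>
  A QR decomposition in which the columns \<open>v i\<close> may be dependent. The index of the
  last summand in the expansion of \<open>v i\<close> expresses triangularity, and the vectors \<open>u\<close> can be found
  one at a time because the condition on \<open>v i\<close> involves only \<open>u 0, \<dots>, u i\<close>.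
\<close>

lemma triangular_orthonormalization:
  fixes v :: "nat \<Rightarrow> complex ^ 'n"
  assumes "n \<le> CARD('n)"
  shows "\<exists>u. orthonormal_seq n u \<and>
    (\<forall>i<n. v i = (\<Sum>k\<le>i. hinner (v i) (u k) *s u k) \<and>
      hinner (v i) (u i) \<in> \<real> \<and> 0 \<le> Re (hinner (v i) (u i)))"
  using assms
proof (induction n)
  case 0
  show ?case by (simp add: orthonormal_seq_def)
next
  case (Suc n)
  then obtain u where u: "orthonormal_seq n u"
    and tri: "\<And>i. i < n \<Longrightarrow> v i = (\<Sum>k\<le>i. hinner (v i) (u k) *s u k) \<and>
      hinner (v i) (u i) \<in> \<real> \<and> 0 \<le> Re (hinner (v i) (u i))"
    by auto
  obtain w c where w: "hinner w w = 1" "\<And>k. k < n \<Longrightarrow> hinner w (u k) = 0"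
    and c: "0 \<le> c" "residual n u (v n) = complex_of_real c *s w"
    using orthonormal_extension[OF u, where v = "v n"] Suc.prems
    by (metis Suc_le_lessD)
  have w': "hinner (u k) w = 0" if "k < n" for k
    using w(2)[OF that] cnj_hinner[of w "u k"] by simp
  have decomp: "v n = (\<Sum>k<n. hinner (v n) (u k) *s u k) + complex_of_real c *s w"
    using c(2) by (simp add: residual_def algebra_simps)
  have vw: "hinner (v n) w = complex_of_real c"
    by (subst decomp) (simp add: hinner_add_left hinner_sum_left hinner_scale_left w' w)
  define u' where "u' = u(n := w)"
  have u'_less: "u' k = u k" if "k < n" for k
    using that by (simp add: u'_def)
  have u'_n: "u' n = w" by (simp add: u'_def)
  have "orthonormal_seq (Suc n) u'"
    using u w w' by (auto simp: orthonormal_seq_def u'_def less_Suc_eq)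
  moreover have "v i = (\<Sum>k\<le>i. hinner (v i) (u' k) *s u' k) \<and>
      hinner (v i) (u' i) \<in> \<real> \<and> 0 \<le> Re (hinner (v i) (u' i))" if "i < Suc n" for i
  proof (cases "i = n")
    case True
    have "(\<Sum>k\<le>n. hinner (v n) (u' k) *s u' k)
        = (\<Sum>k<n. hinner (v n) (u k) *s u k) + complex_of_real c *s w"
      by (simp add: lessThan_Suc_atMost[symmetric] u'_less u'_n vw)
    with True vw c(1) decomp show ?thesis by (simp add: u'_n)
  next
    case False
    with that have "i < n" by simp
    moreover from this have "(\<Sum>k\<le>i. hinner (v i) (u' k) *s u' k) = (\<Sum>k\<le>i. hinner (v i) (u k) *s u k)"
      by (intro sum.cong) (auto simp: u'_less)
    ultimately show ?thesis using tri by (simp add: u'_less)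
  qed
  ultimately show ?case by blast
qed

section \<open>The normal form\<close>

lemma nonneg_coefficient_eq_norm:
  assumes "hinner w w = 1" "c \<in> \<real>" "0 \<le> Re c" "x = c *s w"
  shows "c = complex_of_real (norm x)"
proof -
  obtain r where r: "c = complex_of_real r" "0 \<le> r"
    using assms(2,3) by (auto elim: Reals_cases)
  have "complex_of_real ((norm x)\<^sup>2) = hinner x x"
    by (rule hinner_self[symmetric])
  also have "\<dots> = complex_of_real (r\<^sup>2)"
    by (simp add: assms(1,4) r(1) hinner_scale_left hinner_scale_right power2_eq_square)
  finally have "(norm x)\<^sup>2 = r\<^sup>2"
    by (simp only: of_real_eq_iff)
  with r show ?thesis by simp
qed

lemma sum_norm_coefficients:
  assumes "x = (\<Sum>k\<in>K. hinner x (e k) *s e k)"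
  shows "(\<Sum>k\<in>K. (norm (hinner x (e k)))\<^sup>2) = (norm x)\<^sup>2"
proof -
  have "complex_of_real ((norm x)\<^sup>2) = hinner (\<Sum>k\<in>K. hinner x (e k) *s e k) x"
    by (subst assms[symmetric]) (rule hinner_self[symmetric])
  also have "\<dots> = (\<Sum>k\<in>K. hinner x (e k) * cnj (hinner x (e k)))"
    by (simp add: hinner_sum_left hinner_scale_left cnj_hinner)
  also have "\<dots> = complex_of_real (\<Sum>k\<in>K. (norm (hinner x (e k)))\<^sup>2)"
    by (simp add: complex_norm_square del: of_real_power)
  finally show ?thesis
    by (simp only: of_real_eq_iff)
qed

theorem theorem4p1:
  fixes d :: nat and f :: "complex \<Rightarrow> complex ^ 'n" and A :: "nat \<Rightarrow> complex ^ 'n"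
  assumes dim: "CARD('n) = d + 1"
    and f: "\<And>z. f z = (\<Sum>j\<le>d. z ^ j *s A j)"
    and lead: "A d \<noteq> 0"
    and sphere: "polynomial_sphere_map d f"
  shows "\<exists>(e :: nat \<Rightarrow> complex ^ 'n) (a :: nat \<Rightarrow> nat \<Rightarrow> complex).
    orthonormal_basis d e \<and>
    (\<forall>j\<le>d. A j = (\<Sum>k\<le>d. a j k *s e k)) \<and>
    A 0 = complex_of_real (norm (A 0)) *s e 0 \<and>
    A d = complex_of_real (norm (A d)) *s e d \<and>
    (d \<ge> 2 \<longrightarrow>
      (\<exists>\<alpha>::complex.
        a (d - 1) 0 = - \<alpha> * complex_of_real (norm (A d)) \<and>
        a 1 d = cnj \<alpha> * complex_of_real (norm (A 0))) \<and>
      (\<forall>j k. 1 \<le> j \<and> j < k \<and> k \<le> d - 1 \<longrightarrow> a j k = 0) \<and>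
      (\<forall>j\<in>{1..d - 2}. a j j \<in> \<real> \<and> 0 \<le> Re (a j j)) \<and>
      a (d - 1) (d - 1) \<in> \<real> \<and> 0 \<le> Re (a (d - 1) (d - 1)) \<and>
      (\<Sum>j\<le>d. \<Sum>k\<le>d. (norm (a j k))\<^sup>2) = 1 \<and>
      a (d - 1) (d - 1) = complex_of_real
        (sqrt (1 - (\<Sum>(j, k)\<in>{..d} \<times> {..d} - {(d - 1, d - 1)}. (norm (a j k))\<^sup>2))))"
proof -
  have "norm (\<Sum>j\<le>d. z ^ j *s A j) = 1" if "norm z = 1" for z
    using sphere that by (simp add: polynomial_sphere_map_def flip: f)
  note relations = sphere_map_coefficient_relations[OF this]
  have norms: "(\<Sum>j\<le>d. (norm (A j))\<^sup>2) = 1"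
  proof -
    have "complex_of_real (\<Sum>j\<le>d. (norm (A j))\<^sup>2) = complex_of_real 1"
      using relations[of 0] by (simp add: hinner_self)
    then show ?thesis by (simp only: of_real_eq_iff)
  qed

  \<comment> \<open>The cyclic shift \<open>\<pi>\<close> gives the position in the list \<open>A d, A 0, \<dots>, A (d - 1)\<close>.\<close>
  define \<pi> where "\<pi> j = (if j = d then 0 else Suc j)" for j
  define v where "v i = (if i = 0 then A d else A (i - 1))" for i
  have v_\<pi>: "v (\<pi> j) = A j" for j
    by (simp add: v_def \<pi>_def)
  have \<pi>_le: "\<pi> j \<le> d" if "j \<le> d" for j
    using that by (simp add: \<pi>_def)
  have bij: "bij_betw \<pi> {..d} {..d}"
  proof -
    have "inj_on \<pi> {..d}"
      by (auto simp: inj_on_def \<pi>_def split: if_splits)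
    moreover have "\<pi> ` {..d} \<subseteq> {..d}"
      using \<pi>_le by auto
    ultimately show ?thesis
      by (simp add: bij_betw_def endo_inj_surj)
  qed
  obtain u where u: "orthonormal_seq (Suc d) u"
    and tri: "\<And>i. i \<le> d \<Longrightarrow> v i = (\<Sum>k\<le>i. hinner (v i) (u k) *s u k)"
    and diag: "\<And>i. i \<le> d \<Longrightarrow> hinner (v i) (u i) \<in> \<real> \<and> 0 \<le> Re (hinner (v i) (u i))"
    using triangular_orthonormalization[of "Suc d" v] dim by (auto simp: less_Suc_eq_le)
  have orth: "hinner (u i) (u k) = (if i = k then 1 else 0)" if "i \<le> d" "k \<le> d" for i k
    using u that by (simp add: orthonormal_seq_def)
  have below: "hinner (v i) (u m) = 0" if "i < m" "m \<le> d" for i m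
    using that by (subst tri) (simp_all add: hinner_sum_left hinner_scale_left orth)
  have full: "v i = (\<Sum>m\<le>d. hinner (v i) (u m) *s u m)" if "i \<le> d" for i
  proof -
    have "(\<Sum>m\<le>i. hinner (v i) (u m) *s u m) = (\<Sum>m\<le>d. hinner (v i) (u m) *s u m)"
      using that by (intro sum.mono_neutral_left) (auto simp: below)
    with tri[OF that] show ?thesis by simp
  qed

  define e where "e k = u (\<pi> k)" for k
  define a where "a j k = hinner (A j) (e k)" for j k
  have e_unit: "hinner (e k) (e k) = 1" if "k \<le> d" for k
    using that by (simp add: e_def orth \<pi>_le)
  have basis: "orthonormal_basis d e"
    unfolding orthonormal_basis_def
  proof (intro conjI allI impI)
    fix j k assume "j \<le> d" "k \<le> d"
    then show "hinner (e j) (e k) = (if j = k then 1 else 0)"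
      using bij_betw_imp_inj_on[OF bij] by (simp add: e_def orth \<pi>_le inj_on_eq_iff)
  next
    have "e ` {..d} = u ` {..<CARD('n)}"
      using bij_betw_imp_surj_on[OF bij]
      by (simp add: e_def dim lessThan_Suc_atMost flip: image_image)
    then show "vec.span (e ` {..d}) = UNIV"
      using orthonormal_seq_span[of u] u dim by simp
  qed
  have expansion: "A j = (\<Sum>k\<le>d. a j k *s e k)" if "j \<le> d" for j
  proof -
    have "A j = (\<Sum>m\<le>d. hinner (A j) (u m) *s u m)"
      using full[OF \<pi>_le[OF that]] by (simp add: v_\<pi>)
    also have "\<dots> = (\<Sum>k\<le>d. a j k *s e k)"
      unfolding a_def e_def by (rule sum.reindex_bij_betw[OF bij, symmetric])
    finally show ?thesis .
  qed
  have a_diag: "a j j \<in> \<real> \<and> 0 \<le> Re (a j j)" if "j \<le> d" for j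
    using diag[OF \<pi>_le[OF that]] by (simp add: a_def e_def v_\<pi>)

  have last: "A d = complex_of_real (norm (A d)) *s e d"
  proof -
    have "A d = a d d *s e d"
      using tri[of 0] by (simp add: v_def a_def e_def \<pi>_def)
    with nonneg_coefficient_eq_norm[OF e_unit, of d "a d d" "A d"] a_diag[of d]
    show ?thesis by simp
  qed
  have first: "A 0 = complex_of_real (norm (A 0)) *s e 0"
  proof (cases "d = 0")
    case True
    with last show ?thesis by simp
  next
    case False
    have "hinner (A d) (A 0) = 0"
      using relations[of d] False by simp
    then have "hinner (e d) (A 0) = 0"
      using lead by (subst (asm) last) (simp add: hinner_scale_left)
    then have "hinner (A 0) (e d) = 0"
      using cnj_hinner[of "e d" "A 0"] by simp
    moreover have "v 1 = hinner (v 1) (u 0) *s u 0 + hinner (v 1) (u 1) *s u 1"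
      using tri[of 1] False by simp
    ultimately have "A 0 = a 0 0 *s e 0"
      using False by (simp add: v_def a_def e_def \<pi>_def)
    with nonneg_coefficient_eq_norm[OF e_unit, of 0 "a 0 0" "A 0"] a_diag[of 0]
    show ?thesis by simp
  qed

  have corners: "\<exists>\<alpha>. a (d - 1) 0 = - \<alpha> * complex_of_real (norm (A d)) \<and>
      a 1 d = cnj \<alpha> * complex_of_real (norm (A 0))" if "d \<ge> 2"
  proof -
    have "hinner (A (d - 1)) (A 0) + hinner (A d) (A 1) = 0"
      using relations[of "d - 1"] that by simp
    moreover have "hinner (A (d - 1)) (A 0) = complex_of_real (norm (A 0)) * a (d - 1) 0"
      by (subst first) (simp add: hinner_scale_right a_def)
    moreover have "hinner (A d) (A 1) = complex_of_real (norm (A d)) * cnj (a 1 d)"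
      by (subst last) (simp add: hinner_scale_left a_def cnj_hinner)
    ultimately have "cnj (complex_of_real (norm (A 0)) * a (d - 1) 0
        + complex_of_real (norm (A d)) * cnj (a 1 d)) = 0"
      by simp
    then have link: "complex_of_real (norm (A 0)) * cnj (a (d - 1) 0)
        + complex_of_real (norm (A d)) * a 1 d = 0"
      by simp
    \<comment> \<open>The first equation forces this \<open>\<alpha>\<close>; the link between the corners gives the second one.\<close>
    show ?thesis
    proof (intro exI conjI)
      let ?\<alpha> = "- a (d - 1) 0 / complex_of_real (norm (A d))"
      show "a (d - 1) 0 = - ?\<alpha> * complex_of_real (norm (A d))"
        using lead by simp
      have "a 1 d * complex_of_real (norm (A d))
          = - cnj (a (d - 1) 0) * complex_of_real (norm (A 0))"
        using link by (simp add: eq_neg_iff_add_eq_0 algebra_simps)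
      then show "a 1 d = cnj ?\<alpha> * complex_of_real (norm (A 0))"
        using lead by (simp add: field_simps)
    qed
  qed
  have inner: "a j k = 0" if "j < k" "k \<le> d - 1" for j k
    using below[of "Suc j" "Suc k"] that by (simp add: a_def e_def v_def \<pi>_def)
  have total: "(\<Sum>j\<le>d. \<Sum>k\<le>d. (norm (a j k))\<^sup>2) = 1"
  proof -
    have "(\<Sum>k\<le>d. (norm (a j k))\<^sup>2) = (norm (A j))\<^sup>2" if "j \<le> d" for j
      using sum_norm_coefficients[OF expansion[OF that, unfolded a_def]] by (simp only: a_def)
    with norms show ?thesis by simp
  qed
  have corner_entry: "a (d - 1) (d - 1) = complex_of_real
      (sqrt (1 - (\<Sum>(j, k)\<in>{..d} \<times> {..d} - {(d - 1, d - 1)}. (norm (a j k))\<^sup>2)))"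
  proof -
    have "1 = (\<Sum>(j, k)\<in>{..d} \<times> {..d}. (norm (a j k))\<^sup>2)"
      using total by (simp add: sum.cartesian_product)
    also have "\<dots> = (norm (a (d - 1) (d - 1)))\<^sup>2
        + (\<Sum>(j, k)\<in>{..d} \<times> {..d} - {(d - 1, d - 1)}. (norm (a j k))\<^sup>2)"
      by (subst sum.remove[of _ "(d - 1, d - 1)"]) auto
    finally have "1 - (\<Sum>(j, k)\<in>{..d} \<times> {..d} - {(d - 1, d - 1)}. (norm (a j k))\<^sup>2)
        = (norm (a (d - 1) (d - 1)))\<^sup>2"
      by linarith
    moreover have "a (d - 1) (d - 1) = complex_of_real (norm (a (d - 1) (d - 1)))"
      using a_diag[of "d - 1"] by (auto elim: Reals_cases)
    ultimately show ?thesis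
      by (metis norm_ge_zero real_sqrt_unique)
  qed
  have diagonal: "\<forall>j\<in>{1..d - 2}. a j j \<in> \<real> \<and> 0 \<le> Re (a j j)"
    using a_diag by auto
  show ?thesis
    using basis expansion first last corners inner diagonal a_diag[of "d - 1", OF diff_le_self]
      total corner_entry
    by (intro exI[of _ e] exI[of _ a]) blast
qed

end
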